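(* If a metric space $M$ contains a bilipschitz copy of the unit sphere $S_{c_0}$ of $c_0$, then there is a continuous linear surjection from the Banach space $\mathrm{Lip}_0(M)$ onto $\ell_1$.
   Context: All vector spaces are real. For a metric space $(M,\rho)$ with a distinguished base point $e$, $\mathrm{Lip}_0(M)$ is the Banach space of all Lipschitz functions $f\colon M\to\mathbb{R}$ with $f(e)=0$, with norm $\|f\|=\mathrm{Lip}(f)=\sup_{x\neq y}|f(x)-f(y)|/\rho(x,y)$. $S_{c_0}=\{x\in c_0\colon\|x\|_\infty=1\}$ carries the metric induced by the norm. *)

theory Defs
  imports "HOL-Analysis.Analysis"
begin

section \<open>Normed spaces of real-valued functions\<close>

text \<open>
  \<open>V\<close> is a linear subspace of the real functions on a type, with the pointwise operations, and
  \<open>N\<close> is a norm on \<open>V\<close>.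
\<close>

definition normed_fun_space :: "('a \<Rightarrow> real) set \<Rightarrow> (('a \<Rightarrow> real) \<Rightarrow> real) \<Rightarrow> bool" where
  "normed_fun_space V N \<longleftrightarrow>
     (\<lambda>x. 0) \<in> V \<and>
     (\<forall>f\<in>V. \<forall>g\<in>V. (\<lambda>x. f x + g x) \<in> V \<and> N (\<lambda>x. f x + g x) \<le> N f + N g) \<and>
     (\<forall>c. \<forall>f\<in>V. (\<lambda>x. c * f x) \<in> V \<and> N (\<lambda>x. c * f x) = \<bar>c\<bar> * N f) \<and>
     (\<forall>f\<in>V. 0 \<le> N f \<and> (N f = 0 \<longrightarrow> f = (\<lambda>x. 0)))"

text \<open>
  The locale \<^locale>\<open>Metric_space\<close> requires nonnegativity and symmetry of the distance on the
  whole type, whence the irrelevant default value outside \<open>V\<close>.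
\<close>

definition norm_metric :: "('a \<Rightarrow> real) set \<Rightarrow> (('a \<Rightarrow> real) \<Rightarrow> real) \<Rightarrow> ('a \<Rightarrow> real) metric" where
  "norm_metric V N =
     metric (V, \<lambda>f g. if f \<in> V \<and> g \<in> V then N (\<lambda>x. f x - g x) else 0)"

lemma Metric_space_norm:
  assumes "normed_fun_space V N"
  shows "Metric_space V (\<lambda>f g. if f \<in> V \<and> g \<in> V then N (\<lambda>x. f x - g x) else 0)"
proof -
  have add: "(\<lambda>x. f x + g x) \<in> V" "N (\<lambda>x. f x + g x) \<le> N f + N g" if "f \<in> V" "g \<in> V" for f g
    using assms that by (auto simp: normed_fun_space_def)
  have scale: "(\<lambda>x. c * f x) \<in> V" "N (\<lambda>x. c * f x) = \<bar>c\<bar> * N f" if "f \<in> V" for f c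
    using assms that by (auto simp: normed_fun_space_def)
  have pos: "0 \<le> N f" "N f = 0 \<Longrightarrow> f = (\<lambda>x. 0)" if "f \<in> V" for f
    using assms that by (auto simp: normed_fun_space_def)
  have diff: "(\<lambda>x. f x - g x) \<in> V" if "f \<in> V" "g \<in> V" for f g
    using add(1)[OF that(1) scale(1)[OF that(2), of "-1"]] by simp
  have sym: "N (\<lambda>x. f x - g x) = N (\<lambda>x. g x - f x)" if "f \<in> V" "g \<in> V" for f g
    using scale(2)[OF diff[OF that], of "-1"] by simp
  have tri: "N (\<lambda>x. f x - h x) \<le> N (\<lambda>x. f x - g x) + N (\<lambda>x. g x - h x)"
    if "f \<in> V" "g \<in> V" "h \<in> V" for f g h
    using add(2)[OF diff[OF that(1,2)] diff[OF that(2,3)]] by simp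
  have zero: "N (\<lambda>x. f x - g x) = 0 \<longleftrightarrow> f = g" if "f \<in> V" "g \<in> V" for f g
  proof
    assume "N (\<lambda>x. f x - g x) = 0"
    then show "f = g"
      using pos(2)[OF diff[OF that]] by (auto simp: fun_eq_iff)
  next
    assume "f = g"
    then show "N (\<lambda>x. f x - g x) = 0"
      using scale(2)[OF that(1), of 0] by simp
  qed
  show ?thesis
    by unfold_locales (auto simp: pos(1) diff zero tri intro: sym)
qed

lemma mspace_norm_metric: "normed_fun_space V N \<Longrightarrow> mspace (norm_metric V N) = V"
  unfolding norm_metric_def by (rule Metric_space.mspace_metric[OF Metric_space_norm])

lemma mdist_norm_metric:
  assumes "normed_fun_space V N" "f \<in> V" "g \<in> V"
  shows "mdist (norm_metric V N) f g = N (\<lambda>x. f x - g x)"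
  unfolding norm_metric_def Metric_space.mdist_metric[OF Metric_space_norm[OF assms(1)]]
  using assms by simp

definition linear_fun_map ::
    "('a \<Rightarrow> real) set \<Rightarrow> ('b \<Rightarrow> real) set \<Rightarrow> (('a \<Rightarrow> real) \<Rightarrow> 'b \<Rightarrow> real) \<Rightarrow> bool" where
  "linear_fun_map V W T \<longleftrightarrow>
     T \<in> V \<rightarrow> W \<and>
     (\<forall>f\<in>V. \<forall>g\<in>V. T (\<lambda>x. f x + g x) = (\<lambda>n. T f n + T g n)) \<and>
     (\<forall>c. \<forall>f\<in>V. T (\<lambda>x. c * f x) = (\<lambda>n. c * T f n))"

text \<open>Continuity refers to the two norm topologies.\<close>

definition continuous_linear_surjection ::
    "('a \<Rightarrow> real) set \<Rightarrow> (('a \<Rightarrow> real) \<Rightarrow> real) \<Rightarrow> ('b \<Rightarrow> real) set \<Rightarrow> (('b \<Rightarrow> real) \<Rightarrow> real) \<Rightarrow>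
     (('a \<Rightarrow> real) \<Rightarrow> 'b \<Rightarrow> real) \<Rightarrow> bool" where
  "continuous_linear_surjection V N W N' T \<longleftrightarrow>
     linear_fun_map V W T \<and>
     continuous_map (mtopology_of (norm_metric V N)) (mtopology_of (norm_metric W N')) T \<and>
     T ` V = W"


section \<open>The space \<open>Lip\<^sub>0(M)\<close>\<close>

text \<open>
  A real function on the carrier of \<open>M\<close> is represented by its extension by zero to the whole
  type. Unlike \<^const>\<open>extensional\<close> functions, these are closed under the pointwise operations,
  which are the vector space operations used throughout.
\<close>

definition lip0 :: "'a metric \<Rightarrow> 'a \<Rightarrow> ('a \<Rightarrow> real) set" where
  "lip0 M e = {f. (\<forall>x. x \<notin> mspace M \<longrightarrow> f x = 0) \<and>
                  Lipschitz_continuous_map M euclidean_metric f \<and> f e = 0}"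

text \<open>
  The pairs \<open>(x, x)\<close> contribute \<open>0 / 0 = 0\<close>; they only serve to keep the supremum
  meaningful on a one-point space.
\<close>

definition lip_norm :: "'a metric \<Rightarrow> ('a \<Rightarrow> real) \<Rightarrow> real" where
  "lip_norm M f = (SUP (x, y) \<in> mspace M \<times> mspace M. \<bar>f x - f y\<bar> / mdist M x y)"

lemma lip0_zero: "e \<in> mspace M \<Longrightarrow> (\<lambda>x. 0) \<in> lip0 M e"
  by (auto simp: lip0_def Lipschitz_continuous_map_const)

lemma lip0_add:
  assumes "f \<in> lip0 M e" "g \<in> lip0 M e"
  shows "(\<lambda>x. f x + g x) \<in> lip0 M e"
proof -
  obtain B C where B: "\<And>x y. x \<in> mspace M \<Longrightarrow> y \<in> mspace M \<Longrightarrow> \<bar>f x - f y\<bar> \<le> B * mdist M x y"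
    and C: "\<And>x y. x \<in> mspace M \<Longrightarrow> y \<in> mspace M \<Longrightarrow> \<bar>g x - g y\<bar> \<le> C * mdist M x y"
    using assms unfolding lip0_def Lipschitz_continuous_map_def
    by (simp add: dist_real_def) metis
  have "\<bar>f x + g x - (f y + g y)\<bar> \<le> (B + C) * mdist M x y"
    if "x \<in> mspace M" "y \<in> mspace M" for x y
    using B[OF that] C[OF that] by (simp add: algebra_simps)
  then show ?thesis
    using assms by (auto simp: lip0_def Lipschitz_continuous_map_def dist_real_def)
qed

lemma lip0_scale:
  assumes "f \<in> lip0 M e"
  shows "(\<lambda>x. c * f x) \<in> lip0 M e"
proof -
  obtain B where B: "\<And>x y. x \<in> mspace M \<Longrightarrow> y \<in> mspace M \<Longrightarrow> \<bar>f x - f y\<bar> \<le> B * mdist M x y"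
    using assms by (auto simp: lip0_def Lipschitz_continuous_map_def dist_real_def)
  have "\<bar>c * f x - c * f y\<bar> \<le> (\<bar>c\<bar> * B) * mdist M x y"
    if "x \<in> mspace M" "y \<in> mspace M" for x y
    using mult_left_mono[OF B[OF that], of "\<bar>c\<bar>"]
    by (simp add: abs_mult[symmetric] right_diff_distrib mult.assoc)
  then show ?thesis
    using assms by (auto simp: lip0_def Lipschitz_continuous_map_def dist_real_def)
qed

lemma lip0_diff:
  assumes "f \<in> lip0 M e" "g \<in> lip0 M e"
  shows "(\<lambda>x. f x - g x) \<in> lip0 M e"
  using lip0_add[OF assms(1) lip0_scale[OF assms(2), of "-1"]] by simp

lemma lip_norm_bdd_above:
  assumes "f \<in> lip0 M e"
  shows "bdd_above ((\<lambda>(x, y). \<bar>f x - f y\<bar> / mdist M x y) ` (mspace M \<times> mspace M))"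
proof -
  obtain B where "B > 0"
    and B: "\<And>x y. x \<in> mspace M \<Longrightarrow> y \<in> mspace M \<Longrightarrow> \<bar>f x - f y\<bar> \<le> B * mdist M x y"
    using assms by (auto simp: lip0_def Lipschitz_continuous_map_pos dist_real_def)
  have "\<bar>f x - f y\<bar> / mdist M x y \<le> B" if "x \<in> mspace M" "y \<in> mspace M" for x y
    using B[OF that] \<open>B > 0\<close> mdist_nonneg[of M x y]
    by (cases "mdist M x y = 0") (auto simp: pos_divide_le_eq order_less_le)
  then show ?thesis
    by (intro bdd_aboveI[of _ B]) auto
qed

lemma lip_norm_bound:
  assumes "f \<in> lip0 M e" "x \<in> mspace M" "y \<in> mspace M"
  shows "\<bar>f x - f y\<bar> \<le> lip_norm M f * mdist M x y"
proof (cases "x = y")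
  case False
  have "(\<lambda>(x, y). \<bar>f x - f y\<bar> / mdist M x y) (x, y) \<le> lip_norm M f"
    unfolding lip_norm_def by (rule cSUP_upper) (use assms lip_norm_bdd_above in auto)
  moreover have "mdist M x y > 0"
    using False assms mdist_nonneg[of M x y] Metric_space.zero[OF Metric_space_mspace_mdist, of x M y]
    by linarith
  ultimately show ?thesis
    by (simp add: divide_simps)
next
  case True
  have "mdist M y y = 0"
    using Metric_space.zero[OF Metric_space_mspace_mdist assms(3) assms(3)] by blast
  then show ?thesis
    using True by simp
qed

lemma lip_norm_le:
  assumes "e \<in> mspace M" "0 \<le> B"
    and "\<And>x y. x \<in> mspace M \<Longrightarrow> y \<in> mspace M \<Longrightarrow> \<bar>f x - f y\<bar> \<le> B * mdist M x y"
  shows "lip_norm M f \<le> B"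
  unfolding lip_norm_def
proof (rule cSUP_least)
  fix p assume "p \<in> mspace M \<times> mspace M"
  then obtain x y where p: "p = (x, y)" "x \<in> mspace M" "y \<in> mspace M"
    by auto
  show "(case p of (x, y) \<Rightarrow> \<bar>f x - f y\<bar> / mdist M x y) \<le> B"
    using assms(2) assms(3)[OF p(2,3)] mdist_nonneg[of M x y]
    by (cases "mdist M x y = 0") (auto simp: p(1) pos_divide_le_eq order_less_le)
qed (use assms in auto)

lemma lip_norm_nonneg:
  assumes "f \<in> lip0 M e" "e \<in> mspace M"
  shows "0 \<le> lip_norm M f"
proof -
  have "(\<lambda>(x, y). \<bar>f x - f y\<bar> / mdist M x y) (e, e) \<le> lip_norm M f"
    unfolding lip_norm_def by (rule cSUP_upper) (use assms lip_norm_bdd_above in auto)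
  then show ?thesis by simp
qed

lemma normed_fun_space_lip0:
  assumes e: "e \<in> mspace M"
  shows "normed_fun_space (lip0 M e) (lip_norm M)"
proof -
  have add: "lip_norm M (\<lambda>x. f x + g x) \<le> lip_norm M f + lip_norm M g"
    if f: "f \<in> lip0 M e" and g: "g \<in> lip0 M e" for f g
  proof (rule lip_norm_le[OF e])
    show "0 \<le> lip_norm M f + lip_norm M g"
      using lip_norm_nonneg[OF f e] lip_norm_nonneg[OF g e] by simp
    fix x y assume "x \<in> mspace M" "y \<in> mspace M"
    then show "\<bar>f x + g x - (f y + g y)\<bar> \<le> (lip_norm M f + lip_norm M g) * mdist M x y"
      using lip_norm_bound[OF f, of x y] lip_norm_bound[OF g, of x y]
      by (simp add: algebra_simps)
  qed
  have scale_le: "lip_norm M (\<lambda>x. c * f x) \<le> \<bar>c\<bar> * lip_norm M f" if f: "f \<in> lip0 M e" for c f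
  proof (rule lip_norm_le[OF e])
    show "0 \<le> \<bar>c\<bar> * lip_norm M f"
      using lip_norm_nonneg[OF f e] by simp
    fix x y assume "x \<in> mspace M" "y \<in> mspace M"
    then show "\<bar>c * f x - c * f y\<bar> \<le> \<bar>c\<bar> * lip_norm M f * mdist M x y"
      using mult_left_mono[OF lip_norm_bound[OF f, of x y], of "\<bar>c\<bar>"]
      by (simp add: abs_mult[symmetric] right_diff_distrib mult.assoc)
  qed
  have scale: "lip_norm M (\<lambda>x. c * f x) = \<bar>c\<bar> * lip_norm M f" if f: "f \<in> lip0 M e" for c f
  proof (cases "c = 0")
    case True
    then show ?thesis
      using scale_le[OF f, of 0] lip_norm_nonneg[OF lip0_zero[OF e] e] by simp
  next
    case False
    have "lip_norm M f \<le> \<bar>inverse c\<bar> * lip_norm M (\<lambda>x. c * f x)"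
      using scale_le[OF lip0_scale[OF f, of c], of "inverse c"] False
      by (simp add: mult.assoc[symmetric])
    then have "\<bar>c\<bar> * lip_norm M f \<le> lip_norm M (\<lambda>x. c * f x)"
      using False by (simp add: abs_inverse field_simps)
    then show ?thesis
      using scale_le[OF f, of c] by simp
  qed
  have zero: "f = (\<lambda>x. 0)" if f: "f \<in> lip0 M e" and 0: "lip_norm M f = 0" for f
  proof
    fix x show "f x = 0"
      using f lip_norm_bound[OF f _ e, of x] 0 by (cases "x \<in> mspace M") (auto simp: lip0_def)
  qed
  show ?thesis
    unfolding normed_fun_space_def
    by (intro conjI ballI allI impI lip0_zero[OF e] lip0_add lip0_scale add scale
        lip_norm_nonneg[OF _ e] zero)
qed


section \<open>The spaces \<open>\<ell>\<^sub>1\<close> and \<open>c\<^sub>0\<close>\<close>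

definition l1 :: "(nat \<Rightarrow> real) set" where
  "l1 = {x. summable (\<lambda>n. \<bar>x n\<bar>)}"

definition l1_norm :: "(nat \<Rightarrow> real) \<Rightarrow> real" where
  "l1_norm x = (\<Sum>n. \<bar>x n\<bar>)"

lemma normed_fun_space_l1: "normed_fun_space l1 l1_norm"
proof -
  have add: "(\<lambda>n. x n + y n) \<in> l1 \<and> l1_norm (\<lambda>n. x n + y n) \<le> l1_norm x + l1_norm y"
    if "x \<in> l1" "y \<in> l1" for x y
  proof -
    have s: "summable (\<lambda>n. \<bar>x n\<bar>)" "summable (\<lambda>n. \<bar>y n\<bar>)"
      using that by (auto simp: l1_def)
    have xy: "summable (\<lambda>n. \<bar>x n + y n\<bar>)"
      by (rule summable_comparison_test'[OF summable_add[OF s], of 0]) auto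
    have "(\<Sum>n. \<bar>x n + y n\<bar>) \<le> (\<Sum>n. \<bar>x n\<bar> + \<bar>y n\<bar>)"
      by (intro suminf_le abs_triangle_ineq xy summable_add s)
    then show ?thesis
      using xy s by (simp add: l1_def l1_norm_def suminf_add)
  qed
  have scale: "(\<lambda>n. c * x n) \<in> l1 \<and> l1_norm (\<lambda>n. c * x n) = \<bar>c\<bar> * l1_norm x" if "x \<in> l1" for c x
    using that by (auto simp: l1_def l1_norm_def abs_mult suminf_mult intro: summable_mult)
  have "0 \<le> l1_norm x \<and> (l1_norm x = 0 \<longrightarrow> x = (\<lambda>n. 0))" if "x \<in> l1" for x
    using that suminf_eq_zero_iff[of "\<lambda>n. \<bar>x n\<bar>"]
    by (auto simp: l1_def l1_norm_def suminf_nonneg)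
  then show ?thesis
    unfolding normed_fun_space_def using add scale by (simp add: l1_def)
qed

text \<open>
  As \<^typ>\<open>nat\<close> carries the discrete topology, \<^typ>\<open>nat \<Rightarrow>\<^sub>C real\<close> is the space of bounded
  sequences with the supremum norm, of which \<open>c\<^sub>0\<close> is a subspace.
\<close>

definition c0 :: "(nat \<Rightarrow>\<^sub>C real) set" where
  "c0 = {x. apply_bcontfun x \<longlonglongrightarrow> 0}"

definition sphere_c0 :: "(nat \<Rightarrow>\<^sub>C real) metric" where
  "sphere_c0 = submetric euclidean_metric {x \<in> c0. norm x = 1}"


section \<open>Bilipschitz copies\<close>

definition bilipschitz_embedding :: "'a metric \<Rightarrow> 'b metric \<Rightarrow> ('a \<Rightarrow> 'b) \<Rightarrow> bool" where
  "bilipschitz_embedding m1 m2 \<phi> \<longleftrightarrow>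
     \<phi> \<in> mspace m1 \<rightarrow> mspace m2 \<and>
     (\<exists>a>0. \<exists>b>0. \<forall>x\<in>mspace m1. \<forall>y\<in>mspace m1.
        a * mdist m1 x y \<le> mdist m2 (\<phi> x) (\<phi> y) \<and>
        mdist m2 (\<phi> x) (\<phi> y) \<le> b * mdist m1 x y)"

end

theory Submission
  imports Defs
begin

text \<open>
  A sequence of norm one in \<open>c\<^sub>0\<close> is obtained by putting \<open>1\<close> in front of any null sequence with
  values in \<open>[0, 1]\<close>. So the sphere contains, isometrically, all the cubes \<open>{1} \<times> [0, 1]\<^sup>N \<times> {0}\<close>
  with the supremum metric, and it suffices to look at the restrictions of functions to these.

  A Lipschitz function on such a cube has, morally, a gradient \<open>\<nabla>f\<close> almost everywhere, and
  since the metric is the supremum metric, the \<open>\<ell>\<^sub>1\<close> norm of \<open>\<nabla>f\<close> is at most the Lipschitz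
  constant \<open>L\<close>. The mean of \<open>\<nabla>f\<close> over the cube is then a point of \<open>\<ell>\<^sub>1\<close> which depends
  linearly on \<open>f\<close>, and for \<open>f = (y \<mapsto> \<Sum>i. a\<^sub>i y\<^bsub>i+1\<^esub>)\<close> it is the beginning of the sequence \<open>a\<close>.
  Letting \<open>N\<close> tend to infinity along a filter fine enough for all bounded sequences to converge
  gives the operator onto \<open>\<ell>\<^sub>1\<close>; a preimage of \<open>a \<in> \<ell>\<^sub>1\<close> is found by transporting the linear
  functional of \<open>a\<close> to the copy of the sphere and extending it from there to \<open>M\<close> by McShane's
  formula.

  Differentiability is avoided by replacing the gradient by difference quotients on a grid of
  mesh \<open>1 / K\<close>, with \<open>K\<close> much larger than \<open>N\<close>. The bound on the mean of the quotients
  survives for the following reason. For \<open>A \<subseteq> {..<N}\<close>, the increment of \<open>f\<close> under the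
  simultaneous step of \<open>1 / K\<close> in all directions from \<open>A\<close> is at most \<open>L / K\<close>, as such a step has
  length \<open>1 / K\<close> in the supremum metric. This increment is the sum over \<open>n \<in> A\<close> of the increments
  in direction \<open>n\<close>, each taken at a point moved by a few steps in the other directions. The mean
  over a large box hardly notices such a move (\<open>box_mean_almost_invariant\<close>), and so the
  increments in the single directions, all taken at the same point, have almost the same
  mean of their sum (\<open>sum_box_mean_differences\<close>). This bounds the sum of the mean slopes over
  every \<open>A\<close> (\<open>sum_mean_slope_bound\<close>), and hence their \<open>\<ell>\<^sub>1\<close> norm.
\<close>


section \<open>Means over boxes of lattice points\<close>
definition shift :: "'i set \<Rightarrow> ('i \<Rightarrow> nat) \<Rightarrow> 'i \<Rightarrow> nat" where
  "shift A x = (\<lambda>i. x i + of_bool (i \<in> A))"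

text \<open>
  The mean of \<open>h\<close> over the box of side \<open>K\<close> with lowest corner \<open>x\<close> in the coordinates below
  \<open>N\<close>. The recursion over the coordinates makes the arguments below one-dimensional.
\<close>
primrec box_mean :: "nat \<Rightarrow> nat \<Rightarrow> ((nat \<Rightarrow> nat) \<Rightarrow> real) \<Rightarrow> (nat \<Rightarrow> nat) \<Rightarrow> real" where
  "box_mean K 0 = (\<lambda>h. h)"
| "box_mean K (Suc N) = (\<lambda>h x. (\<Sum>j<K. box_mean K N h (x(N := x N + j))) / real K)"

lemma box_mean_add: "box_mean K N (\<lambda>y. g y + h y) x = box_mean K N g x + box_mean K N h x"
  by (induction N arbitrary: x) (auto simp: sum.distrib add_divide_distrib)

lemma box_mean_scale: "box_mean K N (\<lambda>y. c * h y) x = c * box_mean K N h x"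
  by (induction N arbitrary: x) (auto simp: sum_distrib_left)

lemma box_mean_diff: "box_mean K N (\<lambda>y. g y - h y) x = box_mean K N g x - box_mean K N h x"
  using box_mean_add[of K N g "\<lambda>y. -1 * h y" x] box_mean_scale[of K N "-1" h x] by simp

lemma box_mean_shift: "box_mean K N (\<lambda>y. h (shift A y)) x = box_mean K N h (shift A x)"
proof (induction N arbitrary: x)
  case (Suc N)
  have "shift A (x(N := x N + j)) = (shift A x)(N := shift A x N + j)" for j
    by (auto simp: shift_def)
  then show ?case
    using Suc.IH by (simp del: fun_upd_apply)
qed simp

lemma abs_box_mean_le:
  assumes "K > 0" and h: "\<And>y. \<bar>h y\<bar> \<le> b"
  shows "\<bar>box_mean K N h x\<bar> \<le> b"
proof (induction N arbitrary: x)
  case (Suc N)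
  have "\<bar>\<Sum>j<K. box_mean K N h (x(N := x N + j))\<bar> \<le> (\<Sum>j<K. \<bar>box_mean K N h (x(N := x N + j))\<bar>)"
    by (rule sum_abs)
  also have "\<dots> \<le> real K * b"
    using sum_bounded_above[of "{..<K}" "\<lambda>j. \<bar>box_mean K N h (x(N := x N + j))\<bar>" b] Suc.IH by simp
  finally show ?case
    using \<open>K > 0\<close> by (simp add: field_simps)
qed (use h in simp)

lemma box_mean_eq_const:
  assumes "K > 0"
    and "\<And>y. (\<And>i. i < N \<Longrightarrow> y i < x i + K) \<Longrightarrow> (\<And>i. N \<le> i \<Longrightarrow> y i = x i) \<Longrightarrow> h y = c"
  shows "box_mean K N h x = c"
  using assms(2)
proof (induction N arbitrary: x)
  case 0
  then show ?case by simp
next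
  case (Suc N)
  have "box_mean K N h (x(N := x N + j)) = c" if "j < K" for j
  proof (rule Suc.IH)
    fix y
    assume 1: "\<And>i. i < N \<Longrightarrow> y i < (x(N := x N + j)) i + K"
      and 2: "\<And>i. N \<le> i \<Longrightarrow> y i = (x(N := x N + j)) i"
    show "h y = c"
    proof (rule Suc.prems)
      show "y i < x i + K" if "i < Suc N" for i
        using 1[of i] 2[of i] \<open>j < K\<close> that by (cases "i = N") auto
      show "y i = x i" if "Suc N \<le> i" for i
        using 2[of i] that by simp
    qed
  qed
  then show ?case
    using \<open>K > 0\<close> by simp
qed

text \<open>
  In the direction of the step the sum over the box telescopes, so that only the two opposite
  faces of the box remain, which make up the fraction \<open>1 / K\<close> of it each.
\<close>
lemma box_mean_step:
  assumes "K > 0" and h: "\<And>y. \<bar>h y\<bar> \<le> b" and "n < N"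
  shows "\<bar>box_mean K N h (x(n := x n + 1)) - box_mean K N h x\<bar> \<le> 2 * b / K"
  using \<open>n < N\<close>
proof (induction N arbitrary: x)
  case (Suc N)
  define H where "H = box_mean K N h"
  have diff: "box_mean K (Suc N) h (x(n := x n + 1)) - box_mean K (Suc N) h x =
      (\<Sum>j<K. H ((x(n := x n + 1))(N := (x(n := x n + 1)) N + j)) - H (x(N := x N + j))) / K"
    by (simp add: H_def sum_subtractf diff_divide_distrib del: fun_upd_apply)
  show ?case
  proof (cases "n = N")
    case True
    have "(\<Sum>j<K. H ((x(n := x n + 1))(N := (x(n := x n + 1)) N + j)) - H (x(N := x N + j)))
        = (\<Sum>j<K. H (x(N := x N + Suc j)) - H (x(N := x N + j)))"
      using True by simp
    also have "\<dots> = H (x(N := x N + K)) - H (x(N := x N + 0))"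
      by (rule sum_lessThan_telescope)
    finally have "box_mean K (Suc N) h (x(n := x n + 1)) - box_mean K (Suc N) h x =
        (H (x(N := x N + K)) - H (x(N := x N + 0))) / K"
      using diff by (simp only:)
    moreover have "\<bar>H (x(N := x N + K)) - H (x(N := x N + 0))\<bar> \<le> 2 * b"
      using abs_box_mean_le[of K h b, OF \<open>K > 0\<close> h, of N "x(N := x N + K)"]
        abs_box_mean_le[of K h b, OF \<open>K > 0\<close> h, of N "x(N := x N + 0)"] unfolding H_def by linarith
    ultimately show ?thesis
      using \<open>K > 0\<close> by (simp add: divide_right_mono del: fun_upd_apply box_mean.simps)
  next
    case False
    then have "n < N"
      using Suc.prems by simp
    have "\<bar>H ((x(n := x n + 1))(N := (x(n := x n + 1)) N + j)) - H (x(N := x N + j))\<bar> \<le> 2 * b / K" for j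
    proof -
      have "(x(n := x n + 1))(N := (x(n := x n + 1)) N + j) =
          (x(N := x N + j))(n := (x(N := x N + j)) n + 1)"
        using False by auto
      then show ?thesis
        using Suc.IH[OF \<open>n < N\<close>, of "x(N := x N + j)"] unfolding H_def by (simp only:)
    qed
    then have "(\<Sum>j<K. \<bar>H ((x(n := x n + 1))(N := (x(n := x n + 1)) N + j)) - H (x(N := x N + j))\<bar>)
        \<le> real K * (2 * b / K)"
      using sum_bounded_above[of "{..<K}" _ "2 * b / K"] by (simp del: fun_upd_apply)
    then have "\<bar>\<Sum>j<K. H ((x(n := x n + 1))(N := (x(n := x n + 1)) N + j)) - H (x(N := x N + j))\<bar>
        \<le> real K * (2 * b / K)"
      by (rule order_trans[OF sum_abs])
    then show ?thesis
      unfolding diff using \<open>K > 0\<close> by (simp add: abs_divide pos_divide_le_eq mult.commute del: fun_upd_apply)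
  qed
qed simp

lemma shift_insert: "n \<notin> A \<Longrightarrow> shift (insert n A) x = (shift A x)(n := shift A x n + 1)"
  "n \<notin> A \<Longrightarrow> shift (insert n A) x = shift {n} (shift A x)"
  by (auto simp: shift_def)

lemma box_mean_almost_invariant:
  assumes "K > 0" and h: "\<And>y. \<bar>h y\<bar> \<le> b" and "A \<subseteq> {..<N}"
  shows "\<bar>box_mean K N h (shift A x) - box_mean K N h x\<bar> \<le> card A * (2 * b / K)"
proof -
  have "finite A"
    using \<open>A \<subseteq> {..<N}\<close> finite_subset by blast
  then show ?thesis
    using \<open>A \<subseteq> {..<N}\<close>
  proof (induction A)
    case empty
    then show ?case by (simp add: shift_def)
  next
    case (insert n A)
    have "\<bar>box_mean K N h (shift (insert n A) x) - box_mean K N h (shift A x)\<bar> \<le> 2 * b / K"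
      unfolding shift_insert(1)[OF insert.hyps(2)]
      by (rule box_mean_step[OF \<open>K > 0\<close> h]) (use insert.prems in auto)
    moreover have "real (card (insert n A)) * (2 * b / K) = card A * (2 * b / K) + 2 * b / K"
      using insert.hyps by (simp add: algebra_simps add_divide_distrib)
    ultimately show ?case
      using insert.IH insert.prems by fastforce
  qed
qed

text \<open>
  The increment of \<open>g\<close> under a joint step in the directions from \<open>A\<close> telescopes into increments
  in single directions at shifted points; almost invariance of the mean removes the shifts, at
  the price of at most \<open>N\<close> steps for each of the \<open>card A\<close> increments.
\<close>
lemma sum_box_mean_differences:
  assumes "K > 0" and "b \<ge> 0" and g: "\<And>n y. \<bar>g (shift {n} y) - g y\<bar> \<le> b" and "A \<subseteq> {..<N}"
  shows "\<bar>(\<Sum>n\<in>A. box_mean K N (\<lambda>y. g (shift {n} y) - g y) x) -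
      box_mean K N (\<lambda>y. g (shift A y) - g y) x\<bar> \<le> real (card A) * (real N * (2 * b / K))"
proof -
  have "finite A"
    using \<open>A \<subseteq> {..<N}\<close> finite_subset by blast
  then show ?thesis
    using \<open>A \<subseteq> {..<N}\<close>
  proof (induction A)
    case empty
    have "box_mean K N (\<lambda>y. 0) x = 0"
      using box_mean_scale[of K N 0 "\<lambda>y. 0" x] by simp
    then show ?case by (simp add: shift_def)
  next
    case (insert n A)
    define D where "D = (\<lambda>y. g (shift {n} y) - g y)"
    have "box_mean K N (\<lambda>y. g (shift (insert n A) y) - g y) x =
        box_mean K N (\<lambda>y. D (shift A y) + (g (shift A y) - g y)) x"
      by (simp add: D_def shift_insert(2)[OF insert.hyps(2)])
    also have "\<dots> = box_mean K N D (shift A x) + box_mean K N (\<lambda>y. g (shift A y) - g y) x"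
      by (simp only: box_mean_add box_mean_shift)
    finally have split: "box_mean K N (\<lambda>y. g (shift (insert n A) y) - g y) x = \<dots>" .
    have "\<bar>box_mean K N D (shift A x) - box_mean K N D x\<bar> \<le> card A * (2 * b / K)"
      by (rule box_mean_almost_invariant[OF \<open>K > 0\<close>]) (use g insert.prems in \<open>auto simp: D_def\<close>)
    also have "\<dots> \<le> real N * (2 * b / K)"
      using insert.prems card_mono[of "{..<N}" A] \<open>b \<ge> 0\<close>
      by (intro mult_right_mono) auto
    finally have "\<bar>box_mean K N D (shift A x) - box_mean K N D x\<bar> \<le> real N * (2 * b / K)" .
    moreover have "real (card (insert n A)) * (real N * (2 * b / K)) =
        card A * (real N * (2 * b / K)) + real N * (2 * b / K)"
      using insert.hyps by (simp add: algebra_simps add_divide_distrib)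
    moreover have "(\<Sum>n\<in>insert n A. box_mean K N (\<lambda>y. g (shift {n} y) - g y) x) =
        box_mean K N D x + (\<Sum>n\<in>A. box_mean K N (\<lambda>y. g (shift {n} y) - g y) x)"
      using insert.hyps by (simp add: D_def)
    ultimately show ?case
      unfolding split using insert.IH insert.prems by auto
  qed
qed

section \<open>Simultaneous limits of all bounded sequences\<close>

text \<open>
  By Tychonoff's theorem, the evaluations \<open>u \<mapsto> u k\<close> have a cluster point \<open>v\<close> in a product of
  compact intervals, one for every bounded sequence. The indices \<open>k\<close> whose evaluation is close
  to \<open>v\<close> form the desired filter.
\<close>
lemma bounded_sequences_converge_along_filter:
  obtains F :: "nat filter" where "F \<noteq> bot" "F \<le> sequentially"
    "\<And>u :: nat \<Rightarrow> real. Bseq u \<Longrightarrow> \<exists>l. (u \<longlongrightarrow> l) F"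
proof -
  \<comment> \<open>The value \<open>0\<close> for unbounded \<open>u\<close> makes every factor of the product compact.\<close>
  define \<delta> :: "nat \<Rightarrow> (nat \<Rightarrow> real) \<Rightarrow> real" where "\<delta> = (\<lambda>k u. if Bseq u then u k else 0)"
  have "\<exists>b. \<forall>k. \<delta> k u \<in> {-b..b}" for u
  proof (cases "Bseq u")
    case True
    then obtain K where "\<And>n. \<bar>u n\<bar> \<le> K"
      by (auto simp: Bseq_def)
    then show ?thesis
      using True by (intro exI[of _ K]) (auto simp: \<delta>_def abs_le_iff minus_le_iff)
  next
    case False
    then show ?thesis
      by (intro exI[of _ 0]) (auto simp: \<delta>_def)
  qed
  then obtain b where b: "\<And>u k. \<delta> k u \<in> {-b u..b u}"
    by metis
  have "compact (PiE UNIV (\<lambda>u. {-b u..b u}))"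
    unfolding compactin_euclidean_iff[symmetric] euclidean_product_topology[symmetric]
    by (simp add: compactin_PiE)
  moreover have "eventually (\<lambda>v. v \<in> PiE UNIV (\<lambda>u. {-b u..b u})) (filtermap \<delta> sequentially)"
    using b by (simp add: eventually_filtermap PiE_UNIV_domain)
  moreover have "filtermap \<delta> sequentially \<noteq> bot"
    by (simp add: filtermap_bot_iff)
  ultimately obtain v where v: "inf (nhds v) (filtermap \<delta> sequentially) \<noteq> bot"
    unfolding compact_filter by blast
  define F where "F = inf (filtercomap \<delta> (nhds v)) sequentially"
  show thesis
  proof
    show "F \<noteq> bot"
    proof
      assume "F = bot"
      then obtain P Q where P: "eventually P (nhds v)" and Q: "eventually Q sequentially"
        and PQ: "\<And>k. P (\<delta> k) \<Longrightarrow> Q k \<Longrightarrow> False"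
        unfolding F_def trivial_limit_def eventually_inf eventually_filtercomap by blast
      have "eventually (\<lambda>w. \<not> P w) (filtermap \<delta> sequentially)"
        unfolding eventually_filtermap using Q by (rule eventually_mono) (use PQ in blast)
      with P have "eventually (\<lambda>w. False) (inf (nhds v) (filtermap \<delta> sequentially))"
        unfolding eventually_inf by blast
      with v show False
        by (simp add: trivial_limit_def)
    qed
    show "F \<le> sequentially"
      by (simp add: F_def)
    show "\<exists>l. (u \<longlongrightarrow> l) F" if "Bseq u" for u :: "nat \<Rightarrow> real"
    proof
      have "((\<lambda>w. w u) \<longlongrightarrow> v u) (nhds v)"
        using continuous_on_product_coordinates[where i = u] tendsto_at_iff_tendsto_nhds[of "\<lambda>w. w u" v]
        unfolding continuous_on_def by blast
      then have "((\<lambda>k. \<delta> k u) \<longlongrightarrow> v u) (filtercomap \<delta> (nhds v))"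
        by (rule filterlim_compose) (rule filterlim_filtercomap)
      then have "(u \<longlongrightarrow> v u) (filtercomap \<delta> (nhds v))"
        using that by (simp add: \<delta>_def)
      then show "(u \<longlongrightarrow> v u) F"
        by (rule filterlim_mono) (simp_all add: F_def)
    qed
  qed
qed


section \<open>Mean slopes of functions on the sphere of \<open>c\<^sub>0\<close>\<close>
lemma l1_from_subset_sums:
  fixes u :: "nat \<Rightarrow> real"
  assumes "\<And>A. finite A \<Longrightarrow> \<bar>\<Sum>n\<in>A. u n\<bar> \<le> B"
  shows "u \<in> l1" and "l1_norm u \<le> 2 * B"
proof -
  have partial: "(\<Sum>n<N. \<bar>u n\<bar>) \<le> 2 * B" for N
  proof -
    define P where "P = {n\<in>{..<N}. u n \<ge> 0}"
    have "(\<Sum>n<N. \<bar>u n\<bar>) = (\<Sum>n\<in>P. \<bar>u n\<bar>) + (\<Sum>n\<in>{..<N} - P. \<bar>u n\<bar>)"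
      by (subst sum.subset_diff[of P]) (auto simp: P_def)
    also have "(\<Sum>n\<in>P. \<bar>u n\<bar>) = (\<Sum>n\<in>P. u n)"
      by (rule sum.cong) (auto simp: P_def)
    also have "(\<Sum>n\<in>{..<N} - P. \<bar>u n\<bar>) = - (\<Sum>n\<in>{..<N} - P. u n)"
      unfolding sum_negf[symmetric] by (rule sum.cong) (auto simp: P_def)
    finally show ?thesis
      using assms[of P] assms[of "{..<N} - P"] by (auto simp: P_def)
  qed
  have sum: "summable (\<lambda>n. \<bar>u n\<bar>)"
    by (rule summableI_nonneg_bounded[of _ "2 * B"]) (use partial in auto)
  then show "u \<in> l1"
    by (simp add: l1_def)
  show "l1_norm u \<le> 2 * B"
    unfolding l1_norm_def by (rule suminf_le_const[OF sum partial])
qed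

text \<open>
  The first coordinate \<open>1\<close> puts the point on the sphere. Clipping at \<open>1\<close> makes this true for all
  lattice points \<open>x\<close>, including those reached by steps out of the box \<open>{..<K}\<^sup>N\<close>, so
  that the general facts on means over boxes apply.
\<close>
definition grid_point :: "nat \<Rightarrow> nat \<Rightarrow> (nat \<Rightarrow> nat) \<Rightarrow> nat \<Rightarrow>\<^sub>C real" where
  "grid_point K N x =
     Bcontfun (case_nat 1 (\<lambda>i. if i < N then min 1 (real (x i) / K) else 0))"

lemma apply_grid_point:
  "apply_bcontfun (grid_point K N x) =
     case_nat 1 (\<lambda>i. if i < N then min 1 (real (x i) / K) else 0)"
  unfolding grid_point_def
  by (rule Bcontfun_inverse, rule bcontfun_normI[where b = 1]) (auto split: nat.split)

lemma grid_point_in_sphere: "grid_point K N x \<in> mspace sphere_c0"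
proof -
  have "(\<lambda>n. apply_bcontfun (grid_point K N x) n) \<longlonglongrightarrow> 0"
  proof (rule tendsto_eventually)
    have "apply_bcontfun (grid_point K N x) n = 0" if "n \<ge> Suc N" for n
      using that by (auto simp: apply_grid_point split: nat.split)
    then show "\<forall>\<^sub>F n in sequentially. apply_bcontfun (grid_point K N x) n = 0"
      unfolding eventually_sequentially by blast
  qed
  moreover have "norm (grid_point K N x) \<le> 1"
    by (rule norm_bound) (auto simp: apply_grid_point split: nat.split)
  moreover have "norm (grid_point K N x) \<ge> 1"
    using norm_bounded[of "grid_point K N x" 0] by (simp add: apply_grid_point)
  ultimately show ?thesis
    by (simp add: sphere_c0_def c0_def)
qed

lemma dist_grid_point_shift:
  assumes "K > 0"
  shows "dist (grid_point K N (shift A x)) (grid_point K N x) \<le> 1 / K"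
proof (rule dist_bound)
  fix n
  have "\<bar>min 1 (real (x i + of_bool (i \<in> A)) / K) - min 1 (real (x i) / K)\<bar> \<le> 1 / K" for i
  proof -
    have "0 \<le> real (x i + of_bool (i \<in> A)) / K - real (x i) / K"
      "real (x i + of_bool (i \<in> A)) / K - real (x i) / K \<le> 1 / K"
      using \<open>K > 0\<close> by (auto simp: divide_simps)
    then show ?thesis by linarith
  qed
  then show "dist (apply_bcontfun (grid_point K N (shift A x)) n) (apply_bcontfun (grid_point K N x) n) \<le> 1 / K"
    by (cases n) (auto simp: apply_grid_point dist_real_def shift_def)
qed

text \<open>
  By \<open>sum_box_mean_differences\<close>, replacing the joint increment by the single ones costs at most
  \<open>2 N\<^sup>2 / K\<close> times the Lipschitz constant after rescaling by \<open>K\<close>; this choice of \<open>K\<close> makes the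
  factor at most \<open>1\<close>, and is positive also for \<open>N = 0\<close>.
\<close>
definition resolution :: "nat \<Rightarrow> nat" where
  "resolution N = 2 * (N + 1)\<^sup>2"

lemma resolution_pos [simp]: "resolution N > 0"
  by (simp add: resolution_def)

definition mean_slope :: "nat \<Rightarrow> nat \<Rightarrow> ((nat \<Rightarrow>\<^sub>C real) \<Rightarrow> real) \<Rightarrow> real" where
  "mean_slope N n f = resolution N * box_mean (resolution N) N
     (\<lambda>x. f (grid_point (resolution N) N (shift {n} x)) - f (grid_point (resolution N) N x)) (\<lambda>_. 0)"

lemma mean_slope_add: "mean_slope N n (\<lambda>y. f y + g y) = mean_slope N n f + mean_slope N n g"
  unfolding mean_slope_def
  by (simp add: box_mean_add[symmetric] distrib_left[symmetric] algebra_simps)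

lemma mean_slope_scale: "mean_slope N n (\<lambda>y. c * f y) = c * mean_slope N n f"
  unfolding mean_slope_def right_diff_distrib[symmetric] box_mean_scale by simp

lemma mean_slope_beyond:
  assumes "N \<le> n"
  shows "mean_slope N n f = 0"
proof -
  have "grid_point (resolution N) N (shift {n} x) = grid_point (resolution N) N x" for x
    using assms by (intro bcontfun_eqI) (auto simp: apply_grid_point shift_def split: nat.split)
  then show ?thesis
    using box_mean_scale[of _ _ 0 "\<lambda>_. 0"] by (simp add: mean_slope_def)
qed

text \<open>
  The bound does not depend on \<open>N\<close> or \<open>A\<close>: a joint step in all directions from \<open>A\<close> is no longer
  than a step in one direction.
\<close>
lemma sum_mean_slope_bound:
  assumes "L \<ge> 0"
    and f: "\<And>y z. y \<in> mspace sphere_c0 \<Longrightarrow> z \<in> mspace sphere_c0 \<Longrightarrow> \<bar>f y - f z\<bar> \<le> L * dist y z"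
    and "finite A"
  shows "\<bar>\<Sum>n\<in>A. mean_slope N n f\<bar> \<le> 2 * L"
proof -
  define K where "K = resolution N"
  define g where "g = (\<lambda>x. f (grid_point K N x))"
  define B where "B = A \<inter> {..<N}"
  have "K > 0"
    by (simp add: K_def)
  have slope: "\<bar>g (shift C x) - g x\<bar> \<le> L / K" for C x
  proof -
    have "\<bar>g (shift C x) - g x\<bar> \<le> L * dist (grid_point K N (shift C x)) (grid_point K N x)"
      unfolding g_def by (rule f) (rule grid_point_in_sphere)+
    also have "\<dots> \<le> L * (1 / K)"
      using dist_grid_point_shift[OF \<open>K > 0\<close>] \<open>L \<ge> 0\<close> by (rule mult_left_mono)
    finally show ?thesis by simp
  qed
  define S where "S = (\<Sum>n\<in>B. box_mean K N (\<lambda>x. g (shift {n} x) - g x) (\<lambda>_. 0))"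
  have "\<bar>S - box_mean K N (\<lambda>x. g (shift B x) - g x) (\<lambda>_. 0)\<bar>
      \<le> real (card B) * (real N * (2 * (L / K) / K))"
    unfolding S_def
    by (rule sum_box_mean_differences) (use \<open>K > 0\<close> \<open>L \<ge> 0\<close> slope in \<open>auto simp: B_def\<close>)
  also have "\<dots> \<le> real N * (real N * (2 * (L / K) / K))"
    using card_mono[of "{..<N}" B] \<open>L \<ge> 0\<close> by (intro mult_right_mono) (auto simp: B_def)
  also have "\<dots> = (2 * (real N)\<^sup>2) * (L / K) / K"
    by (simp add: power2_eq_square)
  also have "\<dots> \<le> K * (L / K) / K"
  proof (intro divide_right_mono mult_right_mono)
    have "2 * N\<^sup>2 \<le> K"
      by (simp add: K_def resolution_def power_mono)
    then show "2 * (real N)\<^sup>2 \<le> K"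
      by (metis of_nat_le_iff of_nat_mult of_nat_numeral of_nat_power)
  qed (use \<open>L \<ge> 0\<close> in auto)
  also have "\<dots> = L / K"
    using \<open>K > 0\<close> by simp
  finally have "\<bar>S - box_mean K N (\<lambda>x. g (shift B x) - g x) (\<lambda>_. 0)\<bar> \<le> L / K" .
  moreover have "\<bar>box_mean K N (\<lambda>x. g (shift B x) - g x) (\<lambda>_. 0)\<bar> \<le> L / K"
    by (rule abs_box_mean_le[OF \<open>K > 0\<close> slope])
  ultimately have "\<bar>S\<bar> \<le> 2 * (L / K)"
    by linarith
  then have "\<bar>K * S\<bar> \<le> 2 * L"
    using \<open>K > 0\<close> by (simp add: abs_mult field_simps)
  moreover have "(\<Sum>n\<in>A. mean_slope N n f) = (\<Sum>n\<in>B. mean_slope N n f)"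
  proof (rule sum.mono_neutral_right)
    show "\<forall>n\<in>A - B. mean_slope N n f = 0"
      by (auto simp: B_def not_less intro: mean_slope_beyond)
  qed (use \<open>finite A\<close> in \<open>auto simp: B_def\<close>)
  moreover have "(\<Sum>n\<in>B. mean_slope N n f) = K * S"
    by (simp add: mean_slope_def S_def sum_distrib_left K_def g_def)
  ultimately show ?thesis
    by simp
qed

definition pairing :: "(nat \<Rightarrow> real) \<Rightarrow> (nat \<Rightarrow>\<^sub>C real) \<Rightarrow> real" where
  "pairing a y = (\<Sum>i. a i * apply_bcontfun y (Suc i))"

lemma summable_pairing:
  assumes "a \<in> l1"
  shows "summable (\<lambda>i. \<bar>a i * apply_bcontfun y (Suc i)\<bar>)"
proof (rule summable_comparison_test'[of "\<lambda>i. norm y * \<bar>a i\<bar>" 0])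
  show "summable (\<lambda>i. norm y * \<bar>a i\<bar>)"
    using assms by (simp add: l1_def summable_mult)
  show "norm \<bar>a i * apply_bcontfun y (Suc i)\<bar> \<le> norm y * \<bar>a i\<bar>" for i
    using mult_left_mono[OF norm_bounded[of y "Suc i"], of "\<bar>a i\<bar>"]
    by (simp add: abs_mult mult.commute)
qed

lemma pairing_lipschitz:
  assumes "a \<in> l1"
  shows "\<bar>pairing a y - pairing a z\<bar> \<le> l1_norm a * dist y z"
proof -
  have "pairing a y - pairing a z = pairing a (y - z)"
    unfolding pairing_def
    by (subst suminf_diff) (auto intro: summable_rabs_cancel summable_pairing assms simp: right_diff_distrib)
  also have "\<bar>\<dots>\<bar> \<le> (\<Sum>i. \<bar>a i * apply_bcontfun (y - z) (Suc i)\<bar>)"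
    unfolding pairing_def by (rule summable_rabs[OF summable_pairing[OF assms]])
  also have "\<dots> \<le> (\<Sum>i. \<bar>a i\<bar> * norm (y - z))"
  proof (rule suminf_le)
    show "\<bar>a i * apply_bcontfun (y - z) (Suc i)\<bar> \<le> \<bar>a i\<bar> * norm (y - z)" for i
      using mult_left_mono[OF norm_bounded[of "y - z" "Suc i"], of "\<bar>a i\<bar>"] by (simp add: abs_mult)
    show "summable (\<lambda>i. \<bar>a i\<bar> * norm (y - z))"
      using assms by (simp add: l1_def summable_mult2)
  qed (rule summable_pairing[OF assms])
  also have "\<dots> = l1_norm a * dist y z"
    using assms by (simp add: l1_def l1_norm_def suminf_mult2 dist_norm)
  finally show ?thesis .
qed

text \<open>
  On the box \<open>{..<K}\<^sup>N\<close> a step never leaves the part of the lattice where \<open>grid_point\<close>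
  is affine, so all difference quotients of an affine function are equal to its slope.
\<close>
lemma mean_slope_pairing:
  assumes "n < N" and f: "\<And>y. y \<in> mspace sphere_c0 \<Longrightarrow> f y = pairing a y + c"
  shows "mean_slope N n f = a n"
proof -
  define K where "K = resolution N"
  have "K > 0"
    by (simp add: K_def)
  have point: "pairing a (grid_point K N x) = (\<Sum>i<N. a i * min 1 (real (x i) / K))" for x
    unfolding pairing_def by (subst suminf_finite[of "{..<N}"]) (auto simp: apply_grid_point)
  have "box_mean K N (\<lambda>x. f (grid_point K N (shift {n} x)) - f (grid_point K N x)) (\<lambda>_. 0) = a n / K"
  proof (rule box_mean_eq_const[OF \<open>K > 0\<close>])
    fix x :: "nat \<Rightarrow> nat"
    assume x: "\<And>i. i < N \<Longrightarrow> x i < 0 + K"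
    have "f (grid_point K N (shift {n} x)) - f (grid_point K N x) =
        (\<Sum>i<N. a i * (min 1 (real (shift {n} x i) / K) - min 1 (real (x i) / K)))"
      by (simp add: f grid_point_in_sphere point sum_subtractf right_diff_distrib)
    also have "\<dots> = (\<Sum>i<N. if i = n then a n / K else 0)"
    proof (rule sum.cong)
      fix i assume "i \<in> {..<N}"
      then have "real (x i) + 1 \<le> K"
        using x[of i] by simp
      then have "min 1 (real (x i) / K) = real (x i) / K"
        "min 1 ((real (x i) + 1) / K) = (real (x i) + 1) / K"
        using \<open>K > 0\<close> by (simp_all add: min_def)
      then show "a i * (min 1 (real (shift {n} x i) / K) - min 1 (real (x i) / K)) =
          (if i = n then a n / K else 0)"
        by (cases "i = n") (simp_all add: shift_def add.commute diff_divide_distrib[symmetric])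
    qed simp
    also have "\<dots> = a n / K"
      using \<open>n < N\<close> by simp
    finally show "f (grid_point K N (shift {n} x)) - f (grid_point K N x) = a n / K" .
  qed
  then show ?thesis
    using \<open>K > 0\<close> by (simp add: mean_slope_def K_def)
qed

section \<open>Lipschitz extension and the surjection\<close>

text \<open>
  The extension is the largest one with Lipschitz constant \<open>C\<close>. The function \<open>g\<close> is given on
  a parameter set; if two parameters have the same image under \<open>\<phi>\<close>, the hypothesis on \<open>g\<close>
  makes their values equal.
\<close>
lemma McShane_extension:
  fixes g :: "'i \<Rightarrow> real"
  assumes "S \<noteq> {}" and "C \<ge> 0" and \<phi>: "\<phi> ` S \<subseteq> mspace M"
    and g: "\<And>y z. y \<in> S \<Longrightarrow> z \<in> S \<Longrightarrow> \<bar>g y - g z\<bar> \<le> C * mdist M (\<phi> y) (\<phi> z)"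
  obtains G where "\<And>y. y \<in> S \<Longrightarrow> G (\<phi> y) = g y"
    "\<And>p q. p \<in> mspace M \<Longrightarrow> q \<in> mspace M \<Longrightarrow> \<bar>G p - G q\<bar> \<le> C * mdist M p q"
proof -
  define G where "G = (\<lambda>p. INF y\<in>S. g y + C * mdist M p (\<phi> y))"
  obtain z where "z \<in> S"
    using \<open>S \<noteq> {}\<close> by blast
  interpret Metric_space "mspace M" "mdist M"
    by (rule Metric_space_mspace_mdist)
  have tri: "C * mdist M p r \<le> C * mdist M p q + C * mdist M q r"
    if "p \<in> mspace M" "q \<in> mspace M" "r \<in> mspace M" for p q r
    using mult_left_mono[OF triangle[OF that] \<open>C \<ge> 0\<close>] by (simp add: distrib_left)
  have bdd: "bdd_below ((\<lambda>y. g y + C * mdist M p (\<phi> y)) ` S)" if "p \<in> mspace M" for p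
  proof (rule bdd_belowI2)
    fix y assume "y \<in> S"
    then show "g z - C * mdist M p (\<phi> z) \<le> g y + C * mdist M p (\<phi> y)"
      using g[OF \<open>z \<in> S\<close> \<open>y \<in> S\<close>] tri[of "\<phi> z" p "\<phi> y"] \<phi> \<open>z \<in> S\<close> \<open>y \<in> S\<close> that
        commute[of p "\<phi> z"] by (simp add: abs_le_iff image_subset_iff)
  qed
  have le: "G p \<le> G q + C * mdist M p q" if "p \<in> mspace M" "q \<in> mspace M" for p q
  proof -
    have "G p - C * mdist M p q \<le> G q"
      unfolding G_def
    proof (rule cINF_greatest[OF \<open>S \<noteq> {}\<close>])
      fix y assume "y \<in> S"
      have "(INF y\<in>S. g y + C * mdist M p (\<phi> y)) \<le> g y + C * mdist M p (\<phi> y)"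
        by (rule cINF_lower[OF bdd[OF that(1)] \<open>y \<in> S\<close>])
      then show "(INF y\<in>S. g y + C * mdist M p (\<phi> y)) - C * mdist M p q \<le> g y + C * mdist M q (\<phi> y)"
        using tri[OF that, of "\<phi> y"] \<phi> \<open>y \<in> S\<close> by auto
    qed
    then show ?thesis by simp
  qed
  show thesis
  proof
    show "G (\<phi> y) = g y" if "y \<in> S" for y
    proof (rule antisym)
      have "mdist M (\<phi> y) (\<phi> y) = 0"
        using \<phi> that by auto
      then show "G (\<phi> y) \<le> g y"
        using cINF_lower[OF bdd[of "\<phi> y"] that] \<phi> that by (auto simp: G_def)
      show "g y \<le> G (\<phi> y)"
        unfolding G_def
        by (rule cINF_greatest[OF \<open>S \<noteq> {}\<close>]) (use g[OF that] in \<open>fastforce simp: abs_le_iff\<close>)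
    qed
    show "\<bar>G p - G q\<bar> \<le> C * mdist M p q" if "p \<in> mspace M" "q \<in> mspace M" for p q
      using le[OF that] le[OF that(2,1)] commute[of p q] by auto
  qed
qed

lemma continuous_linear_surjectionI:
  assumes V: "normed_fun_space V N" and W: "normed_fun_space W N'"
    and lin: "linear_fun_map V W T"
    and bound: "\<And>f. f \<in> V \<Longrightarrow> N' (T f) \<le> C * N f"
    and onto: "\<And>w. w \<in> W \<Longrightarrow> \<exists>f\<in>V. T f = w"
  shows "continuous_linear_surjection V N W N' T"
proof -
  have TV: "T f \<in> W" if "f \<in> V" for f
    using lin that by (auto simp: linear_fun_map_def)
  have "Lipschitz_continuous_map (norm_metric V N) (norm_metric W N') T"
    unfolding Lipschitz_continuous_map_def mspace_norm_metric[OF V] mspace_norm_metric[OF W]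
  proof (intro conjI exI ballI)
    show "T \<in> V \<rightarrow> W"
      using TV by blast
    fix f g assume fg: "f \<in> V" "g \<in> V"
    have neg: "(\<lambda>x. -1 * g x) \<in> V"
      using V fg unfolding normed_fun_space_def by blast
    have "(\<lambda>x. f x + -1 * g x) \<in> V"
      using V fg(1) neg unfolding normed_fun_space_def by fast
    moreover have "T (\<lambda>x. f x + -1 * g x) = (\<lambda>n. T f n + T (\<lambda>x. -1 * g x) n)"
      using lin fg(1) neg unfolding linear_fun_map_def by fast
    moreover have "T (\<lambda>x. -1 * g x) = (\<lambda>n. -1 * T g n)"
      using lin fg unfolding linear_fun_map_def by blast
    ultimately show "mdist (norm_metric W N') (T f) (T g) \<le> C * mdist (norm_metric V N) f g"
      using bound[of "\<lambda>x. f x - g x"] fg TV by (simp add: mdist_norm_metric[OF V] mdist_norm_metric[OF W])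
  qed
  then show ?thesis
    unfolding continuous_linear_surjection_def
    using lin TV onto by (auto intro: Lipschitz_continuous_imp_continuous_map)
qed

theorem corollary5p7:
  fixes M :: "'a metric" and e :: 'a
  assumes "e \<in> mspace M"
    and "\<exists>\<phi>. bilipschitz_embedding sphere_c0 M \<phi>"
  shows "\<exists>T. continuous_linear_surjection (lip0 M e) (lip_norm M) l1 l1_norm T"
proof -
  define S where "S = mspace sphere_c0"
  have mdist_S: "mdist sphere_c0 = dist"
    by (simp add: sphere_c0_def)
  obtain \<phi> \<alpha> \<beta> where \<phi>: "\<phi> \<in> S \<rightarrow> mspace M" and "\<alpha> > 0" and "\<beta> > 0"
    and lower: "\<And>y z. y \<in> S \<Longrightarrow> z \<in> S \<Longrightarrow> \<alpha> * dist y z \<le> mdist M (\<phi> y) (\<phi> z)"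
    and upper: "\<And>y z. y \<in> S \<Longrightarrow> z \<in> S \<Longrightarrow> mdist M (\<phi> y) (\<phi> z) \<le> \<beta> * dist y z"
    using assms(2) unfolding bilipschitz_embedding_def S_def mdist_S by blast
  obtain F :: "nat filter" where "F \<noteq> bot" and F: "F \<le> sequentially"
    and conv: "\<And>u :: nat \<Rightarrow> real. Bseq u \<Longrightarrow> \<exists>l. (u \<longlongrightarrow> l) F"
    by (rule bounded_sequences_converge_along_filter) blast
  define T where "T = (\<lambda>f n. Lim F (\<lambda>N. mean_slope N n (\<lambda>y. f (\<phi> y))))"
  have slopes: "\<bar>\<Sum>n\<in>A. mean_slope N n (\<lambda>y. f (\<phi> y))\<bar> \<le> 2 * (lip_norm M f * \<beta>)"
    if f: "f \<in> lip0 M e" and "finite A" for f A N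
  proof (rule sum_mean_slope_bound)
    show "0 \<le> lip_norm M f * \<beta>"
      using lip_norm_nonneg[OF f assms(1)] \<open>\<beta> > 0\<close> by simp
    fix y z assume yz: "y \<in> mspace sphere_c0" "z \<in> mspace sphere_c0"
    have "\<bar>f (\<phi> y) - f (\<phi> z)\<bar> \<le> lip_norm M f * mdist M (\<phi> y) (\<phi> z)"
      using \<phi> yz by (intro lip_norm_bound[OF f]) (auto simp: S_def)
    also have "\<dots> \<le> lip_norm M f * (\<beta> * dist y z)"
      using upper yz lip_norm_nonneg[OF f assms(1)] by (intro mult_left_mono) (auto simp: S_def)
    finally show "\<bar>f (\<phi> y) - f (\<phi> z)\<bar> \<le> lip_norm M f * \<beta> * dist y z"
      by (simp add: mult.assoc)
  qed fact
  have lim: "((\<lambda>N. mean_slope N n (\<lambda>y. f (\<phi> y))) \<longlongrightarrow> T f n) F" if f: "f \<in> lip0 M e" for f n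
  proof -
    have "Bseq (\<lambda>N. mean_slope N n (\<lambda>y. f (\<phi> y)))"
      using slopes[OF f, of "{n}"] by (intro BseqI'[where K = "2 * (lip_norm M f * \<beta>)"]) auto
    then obtain l where "((\<lambda>N. mean_slope N n (\<lambda>y. f (\<phi> y))) \<longlongrightarrow> l) F"
      using conv by blast
    then show ?thesis
      unfolding T_def using tendsto_Lim[OF \<open>F \<noteq> bot\<close>] by metis
  qed
  have bounds: "T f \<in> l1" "l1_norm (T f) \<le> 4 * \<beta> * lip_norm M f" if f: "f \<in> lip0 M e" for f
  proof -
    have "\<bar>\<Sum>n\<in>A. T f n\<bar> \<le> 2 * (lip_norm M f * \<beta>)" if "finite A" for A
    proof (rule tendsto_upperbound[OF _ _ \<open>F \<noteq> bot\<close>])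
      show "((\<lambda>N. \<bar>\<Sum>n\<in>A. mean_slope N n (\<lambda>y. f (\<phi> y))\<bar>) \<longlongrightarrow> \<bar>\<Sum>n\<in>A. T f n\<bar>) F"
        by (intro tendsto_rabs tendsto_sum lim f)
    qed (use slopes[OF f that] in auto)
    then show "T f \<in> l1" "l1_norm (T f) \<le> 4 * \<beta> * lip_norm M f"
      using l1_from_subset_sums[of "T f" "2 * (lip_norm M f * \<beta>)"] by (simp_all add: mult_ac)
  qed
  have linear: "linear_fun_map (lip0 M e) l1 T"
    unfolding linear_fun_map_def
  proof (intro conjI ballI allI ext)
    show "T \<in> lip0 M e \<rightarrow> l1"
      using bounds by blast
    show "T (\<lambda>x. f x + g x) n = T f n + T g n" if "f \<in> lip0 M e" "g \<in> lip0 M e" for f g n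
      using tendsto_add[OF lim[OF that(1), of n] lim[OF that(2), of n]] lim[OF lip0_add[OF that], of n]
      by (intro tendsto_unique[OF \<open>F \<noteq> bot\<close>]) (auto simp: mean_slope_add)
    show "T (\<lambda>x. c * f x) n = c * T f n" if "f \<in> lip0 M e" for c f n
      using tendsto_mult_left[OF lim[OF that, of n], of c] lim[OF lip0_scale[OF that], of n]
      by (intro tendsto_unique[OF \<open>F \<noteq> bot\<close>]) (auto simp: mean_slope_scale)
  qed
  have onto: "\<exists>f\<in>lip0 M e. T f = a" if a: "a \<in> l1" for a
  proof -
    have "l1_norm a \<ge> 0"
      using a by (simp add: l1_def l1_norm_def suminf_nonneg)
    define C where "C = l1_norm a / \<alpha>"
    have "\<bar>pairing a y - pairing a z\<bar> \<le> C * mdist M (\<phi> y) (\<phi> z)" if "y \<in> S" "z \<in> S" for y z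
    proof -
      have "\<bar>pairing a y - pairing a z\<bar> \<le> C * (\<alpha> * dist y z)"
        using pairing_lipschitz[OF a, of y z] \<open>\<alpha> > 0\<close> by (simp add: C_def)
      also have "\<dots> \<le> C * mdist M (\<phi> y) (\<phi> z)"
        using lower[OF that] \<open>l1_norm a \<ge> 0\<close> \<open>\<alpha> > 0\<close> by (intro mult_left_mono) (auto simp: C_def)
      finally show ?thesis .
    qed
    moreover have "S \<noteq> {}" "C \<ge> 0" "\<phi> ` S \<subseteq> mspace M"
      using grid_point_in_sphere \<open>l1_norm a \<ge> 0\<close> \<open>\<alpha> > 0\<close> \<phi> by (auto simp: S_def C_def)
    ultimately obtain G where G: "\<And>y. y \<in> S \<Longrightarrow> G (\<phi> y) = pairing a y"
      and lip: "\<And>p q. p \<in> mspace M \<Longrightarrow> q \<in> mspace M \<Longrightarrow> \<bar>G p - G q\<bar> \<le> C * mdist M p q"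
      using McShane_extension[of S C \<phi> M "pairing a"] by blast
    \<comment> \<open>Subtracting the value at the base point changes no slope.\<close>
    define f where "f = (\<lambda>p. if p \<in> mspace M then G p - G e else 0)"
    have f: "f \<in> lip0 M e"
      using lip assms(1)
      by (auto simp: lip0_def f_def Lipschitz_continuous_map_def dist_real_def intro!: exI[of _ C])
    have "T f n = a n" for n
    proof (rule tendsto_unique[OF \<open>F \<noteq> bot\<close> lim[OF f]])
      have "mean_slope N n (\<lambda>y. f (\<phi> y)) = a n" if "n < N" for N
        using that by (rule mean_slope_pairing[where c = "- G e"]) (use G \<phi> in \<open>auto simp: f_def S_def\<close>)
      then have "eventually (\<lambda>N. mean_slope N n (\<lambda>y. f (\<phi> y)) = a n) sequentially"
        by (intro eventually_sequentiallyI[of "Suc n"]) auto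
      then show "((\<lambda>N. mean_slope N n (\<lambda>y. f (\<phi> y))) \<longlongrightarrow> a n) F"
        using F by (intro tendsto_eventually) (rule filter_leD)
    qed
    with f show ?thesis
      by blast
  qed
  show ?thesis
    using continuous_linear_surjectionI[OF normed_fun_space_lip0[OF assms(1)] normed_fun_space_l1
      linear bounds(2) onto] by blast
qed

end
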